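(* Let $2k\ge 3$ be an integer. For all sufficiently large $d\in\mathbb{N}$ (depending on $k$) the following holds: an additive quaternary block code $C\subseteq \mathbb{F}_4^n$ with $|C|=4^k$ and minimum Hamming distance $d$ exists if and only if $$n\ge \left\lceil \frac{g(2k,2d)}{3}\right\rceil=\left\lceil \frac{\sum_{i=0}^{2k-1}\left\lceil\frac{2d}{2^i}\right\rceil}{3}\right\rceil .$$
   Context: A quaternary block code of length $n$ is a subset of $\mathbb{F}_4^n$; it is additive if it is closed under componentwise addition. For positive integers $m,e$ put $g(m,e):=\sum_{i=0}^{m-1}\left\lceil \frac{e}{2^i}\right\rceil$. *)

theory Defs
  imports Complex_Main "Jordan_Normal_Form.Matrix"
begin

text \<open>
  Words of length \<open>n\<close> over a field \<open>'a\<close> are the elements of \<open>carrier_vec n\<close>, so that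
  vector addition is componentwise. For quaternary codes \<open>'a\<close> is a field with four elements.
\<close>

definition block_code :: "nat \<Rightarrow> 'a vec set \<Rightarrow> bool" where
  "block_code n C \<longleftrightarrow> C \<subseteq> carrier_vec n"

definition additive_code :: "'a::plus vec set \<Rightarrow> bool" where
  "additive_code C \<longleftrightarrow> (\<forall>x\<in>C. \<forall>y\<in>C. x + y \<in> C)"

definition hamming_dist :: "'a vec \<Rightarrow> 'a vec \<Rightarrow> nat" where
  "hamming_dist x y = card {i. i < dim_vec x \<and> x $ i \<noteq> y $ i}"

text \<open>Meaningful only for finite codes with at least two words, since \<open>Min\<close> is unspecified
  on empty and infinite sets.\<close>

definition min_dist :: "'a vec set \<Rightarrow> nat" where
  "min_dist C = Min {hamming_dist x y | x y. x \<in> C \<and> y \<in> C \<and> x \<noteq> y}"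

definition griesmer_sum :: "nat \<Rightarrow> nat \<Rightarrow> int" where
  "griesmer_sum m e = (\<Sum>i = 0..<m. \<lceil>real e / 2 ^ i\<rceil>)"

end

theory Submission
  imports Defs
begin

text \<open>
  Concatenation with the binary even weight code of length 3 turns an additive quaternary code of
  length \<open>n\<close> and minimum distance \<open>d\<close> into a binary linear code of length \<open>3 n\<close> and minimum distance
  \<open>2 d\<close>, so that the Griesmer bound applies.

  Conversely, codewords are functionals on the binary space \<open>V\<close> of dimension \<open>m\<close>, and the coordinates
  of a code are lines of \<open>V\<close> (possibly degenerate). Write \<open>d = \<sigma> 2^(m - 2) - (\<Sum>j\<in>J. 2^j)\<close>
  with \<open>J \<subseteq> {..<m - 2}\<close>. As in the Solomon--Stiffler construction, the point multiset consisting of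
  \<open>\<sigma>\<close> copies of \<open>V\<close> minus a subspace of dimension \<open>j + 2\<close> for every \<open>j \<in> J\<close> has the right
  weights and \<open>g(m, 2 d)\<close> points. All these subspaces share a point \<open>a\<close>, and the lines through \<open>a\<close>
  express each of them as an integral combination of lines and of the degenerate line \<open>2 a\<close>. In turn,
  \<open>6 a\<close> is an integral combination of two lines in total, so at most two degenerate lines remain.
  For large \<open>\<sigma>\<close> the negative coefficients are compensated by copies of the set of all lines, which
  covers every point of \<open>V\<close> equally often.
\<close>

section \<open>The Griesmer bound\<close>

text \<open>Nested ceilings collapse: ceil(e / 2^(i+1)) = ceil(ceil(e / 2) / 2^i). The recursion
  matches the passage from a code to its residual code.\<close>

lemma griesmer_sum_Suc:
  "griesmer_sum (Suc m) e = int e + griesmer_sum m ((e + 1) div 2)"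
proof -
  have half: "\<lceil>real e / 2 ^ Suc i\<rceil> = \<lceil>real ((e + 1) div 2) / 2 ^ i\<rceil>" for i
  proof -
    have "\<lceil>real e / 2 ^ Suc i\<rceil> \<le> z \<longleftrightarrow> \<lceil>real ((e + 1) div 2) / 2 ^ i\<rceil> \<le> z" for z
    proof -
      have "\<lceil>real e / 2 ^ Suc i\<rceil> \<le> z \<longleftrightarrow> real e \<le> of_int (z * 2 ^ Suc i)"
        by (simp add: ceiling_le_iff field_simps)
      also have "\<dots> \<longleftrightarrow> int e \<le> 2 * (z * 2 ^ i)"
        by (metis mult.left_commute of_int_le_iff of_int_of_nat_eq power_Suc)
      also have "\<dots> \<longleftrightarrow> int ((e + 1) div 2) \<le> z * 2 ^ i"
        by linarith
      also have "\<dots> \<longleftrightarrow> real ((e + 1) div 2) \<le> of_int (z * 2 ^ i)"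
        by (metis of_int_le_iff of_int_of_nat_eq)
      also have "\<dots> \<longleftrightarrow> \<lceil>real ((e + 1) div 2) / 2 ^ i\<rceil> \<le> z"
        by (simp add: ceiling_le_iff field_simps)
      finally show ?thesis .
    qed
    then show ?thesis by (meson order_antisym order_refl)
  qed
  show ?thesis
    unfolding griesmer_sum_def sum.atLeast0_lessThan_Suc_shift by (simp add: half del: power_Suc)
qed

lemma griesmer_sum_mono: "e \<le> e' \<Longrightarrow> griesmer_sum m e \<le> griesmer_sum m e'"
  unfolding griesmer_sum_def by (intro sum_mono ceiling_mono divide_right_mono) auto

lemma card_eq_fibres:
  assumes "finite A" and "\<And>y. y \<in> f ` A \<Longrightarrow> card {x \<in> A. f x = y} = c"
  shows "card A = c * card (f ` A)"
proof -
  have "card A = (\<Sum>y\<in>f ` A. card {x \<in> A. f x = y})"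
    using sum.image_gen[OF assms(1), of "\<lambda>_. 1::nat" f] by simp
  then show ?thesis using assms(2) by simp
qed

text \<open>Source of the residual weight bound: if \<open>x\<close> and \<open>sym_diff x w\<close>
  both have at least \<open>card w\<close> elements, then so does \<open>x - w\<close> counted
  twice.\<close>

lemma card_sym_diff_add:
  assumes "finite x" "finite w"
  shows "card x + card (sym_diff x w) = 2 * card (x - w) + card w"
proof -
  have "card (sym_diff x w) = card (x - w) + card (w - x)"
    using assms by (intro card_Un_disjoint) auto
  moreover have "card x = card (x - w) + card (x \<inter> w)"
    using assms by (subst card_Un_disjoint[symmetric]) (auto intro: arg_cong[of _ _ card])
  moreover have "card w = card (w - x) + card (x \<inter> w)"
    using assms by (subst card_Un_disjoint[symmetric]) (auto intro: arg_cong[of _ _ card])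
  ultimately show ?thesis by simp
qed

text \<open>A binary linear code is represented by the supports of its words; addition becomes
  symmetric difference. The induction passes to the residual code \<open>x \<mapsto> x - w\<close> with respect to
  a word \<open>w\<close> of minimum weight.\<close>

lemma griesmer_bound:
  assumes "finite N" "C \<subseteq> Pow N" "\<And>x y. x \<in> C \<Longrightarrow> y \<in> C \<Longrightarrow> sym_diff x y \<in> C"
    and "card C = 2 ^ m" and "\<And>x. x \<in> C \<Longrightarrow> x \<noteq> {} \<Longrightarrow> e \<le> card x"
  shows "griesmer_sum m e \<le> int (card N)"
  using assms
proof (induction m arbitrary: N C e)
  case 0
  then show ?case by (simp add: griesmer_sum_def)
next
  case (Suc m)
  have finC: "finite C" using Suc.prems(1,2) finite_subset by blast
  have fin: "finite x" if "x \<in> C" for x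
    using that Suc.prems(1,2) finite_subset by blast
  have "card C \<noteq> 1" "card C \<noteq> 0" using Suc.prems(4) by auto
  then have "C \<noteq> {{}}" "C \<noteq> {}" by auto
  then have ne: "C - {{}} \<noteq> {}" by blast
  then obtain x0 where "x0 \<in> C" by blast
  then have "{} \<in> C" using Suc.prems(3)[of x0 x0] by simp
  obtain w where w: "w \<in> C" "w \<noteq> {}" and wmin: "\<And>x. x \<in> C \<Longrightarrow> x \<noteq> {} \<Longrightarrow> card w \<le> card x"
    using ex_min_if_finite[of "card ` (C - {{}})"] finC ne
    by (auto simp: not_less)
  let ?R = "(\<lambda>x. x - w) ` C"
  have same: "x = y \<or> x = sym_diff y w" if "x \<in> C" "y \<in> C" "x - w = y - w" for x y
  proof -
    let ?z = "sym_diff x y"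
    have z: "?z \<in> C" "?z \<subseteq> w" using that Suc.prems(3) by blast+
    \<comment> \<open>A nonzero codeword inside \<open>w\<close> cannot be lighter than
      \<open>w\<close>, so it is \<open>w\<close>. Hence the residual map is two-to-one.\<close>
    have "?z = {} \<or> ?z = w"
      using z wmin[of ?z] card_seteq[of w ?z] fin[OF w(1)] by blast
    then show ?thesis by blast
  qed
  have "card {x \<in> C. x - w = y} = 2" if y: "y \<in> ?R" for y
  proof -
    obtain x where x: "x \<in> C" "y = x - w" using y by blast
    have "{x' \<in> C. x' - w = y} = {x, sym_diff x w}"
      using x w(1) Suc.prems(3)[of x w] same[of _ x] by auto
    moreover have "x \<noteq> sym_diff x w" using w(2) by blast
    ultimately show ?thesis by simp
  qed
  from card_eq_fibres[OF finC this] have cR: "card ?R = 2 ^ m"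
    using Suc.prems(4) by simp
  have wt: "(card w + 1) div 2 \<le> card y" if y: "y \<in> ?R" "y \<noteq> {}" for y
  proof -
    obtain x where x: "x \<in> C" "y = x - w" using y by blast
    have "card w \<le> card x" using x y wmin by blast
    moreover have "card w \<le> card (sym_diff x w)"
      using x y Suc.prems(3)[of x w] w(1) wmin[of "sym_diff x w"] by blast
    ultimately show ?thesis
      using card_sym_diff_add[of x w] fin x w by simp
  qed
  have "griesmer_sum m ((card w + 1) div 2) \<le> int (card (N - w))"
  proof (rule Suc.IH)
    show "?R \<subseteq> Pow (N - w)" using Suc.prems(2) by blast
    show "sym_diff x y \<in> ?R" if R: "x \<in> ?R" "y \<in> ?R" for x y
    proof -
      obtain x' y' where x': "x' \<in> C" "y' \<in> C" "x = x' - w" "y = y' - w" using R by blast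
      then have "sym_diff x y = sym_diff x' y' - w" by blast
      then show ?thesis using x' Suc.prems(3) by blast
    qed
  qed (use Suc.prems(1) cR wt in auto)
  moreover have "card N = card w + card (N - w)"
    using w Suc.prems(1,2) by (metis PowD card_Diff_subset card_mono fin le_add_diff_inverse subsetD)
  moreover have "griesmer_sum (Suc m) e \<le> griesmer_sum (Suc m) (card w)"
    using Suc.prems(5) w by (intro griesmer_sum_mono) auto
  ultimately show ?case by (simp add: griesmer_sum_Suc)
qed

section \<open>Fields with four elements\<close>

text \<open>Translation by 1 permutes the field and so preserves the sum of all elements; this gives
  4 = 0, hence 2 = 0.\<close>

lemma char_two_if_card_four:
  assumes "card (UNIV :: 'a::field set) = 4"
  shows "(x::'a) + x = 0"
proof -
  have "bij_betw (\<lambda>x::'a. x + 1) UNIV UNIV"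
    by (rule bij_betwI[of _ _ _ "\<lambda>x. x - 1"]) auto
  from sum.reindex_bij_betw[OF this, of "\<lambda>x. x"]
  have "(\<Sum>x\<in>(UNIV::'a set). x + 1) = (\<Sum>x\<in>UNIV. x)" by simp
  then have "of_nat (card (UNIV::'a set)) = (0::'a)"
    by (simp add: sum.distrib)
  then have "(2::'a) * 2 = 0" using assms by simp
  then have "(2::'a) = 0" by (metis mult_eq_0_iff)
  then show ?thesis by (metis mult_2 mult_zero_left)
qed

lemma UNIV_if_card_four:
  assumes "card (UNIV :: 'a::field set) = 4" and "s \<noteq> 0" "x \<noteq> 0" "x \<noteq> (s::'a)"
  shows "(UNIV :: 'a set) = {0, s, x, x + s}"
proof -
  have fin: "finite (UNIV :: 'a set)" using assms(1) card.infinite by fastforce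
  have "x + s \<noteq> 0"
    using char_two_if_card_four[OF assms(1), of s] assms(4) by (metis add_right_cancel)
  then have "card {0, s, x, x + s} = 4" using assms by auto
  then show ?thesis using assms(1) fin by (metis card_subset_eq top_greatest)
qed

text \<open>\<open>{0, s}\<close> is a subgroup of index 2, so lying outside it is a binary linear
  functional.\<close>

lemma add_mem_pair_iff:
  assumes "card (UNIV :: 'a::field set) = 4" and "s \<noteq> (0::'a)"
  shows "x + y \<in> {0, s} \<longleftrightarrow> (x \<in> {0, s} \<longleftrightarrow> y \<in> {0, s})"
proof -
  note two = char_two_if_card_four[OF assms(1)]
  have cancel: "z + (z + w) = w" for z w :: 'a
    by (metis add.assoc add_0 two)
  show ?thesis
  proof (cases "x \<in> {0, s}")
    case True
    then show ?thesis using two cancel by (metis add_0 add.right_neutral insert_iff singletonD)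
  next
    case False
    then have "y \<in> {0, s, x, x + s}" using UNIV_if_card_four[OF assms, of x] by auto
    then show ?thesis using two cancel False
      by (metis add_0 add.right_neutral add.commute insert_iff singletonD)
  qed
qed

text \<open>The additive bijection from the field onto the binary even weight code of length 3 doubles
  weights; its coordinates are the functionals with kernel \<open>{0, s}\<close>.\<close>

definition bin_support :: "'a::field vec \<Rightarrow> (nat \<times> 'a) set" where
  "bin_support v = {(i, s). i < dim_vec v \<and> s \<noteq> 0 \<and> v $ i \<notin> {0, s}}"

lemma bin_support_add:
  assumes "card (UNIV :: 'a::field set) = 4" and "x \<in> carrier_vec n" "y \<in> carrier_vec n"
  shows "bin_support (x + y :: 'a vec) = sym_diff (bin_support x) (bin_support y)"
proof -
  have "(i, s) \<in> bin_support (x + y) \<longleftrightarrow> (i, s) \<in> sym_diff (bin_support x) (bin_support y)"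
    for i and s :: 'a
  proof (cases "i < n \<and> s \<noteq> 0")
    case True
    then show ?thesis using add_mem_pair_iff[OF assms(1), of s "x $ i" "y $ i"] assms(2,3)
      unfolding bin_support_def by auto
  next
    case False
    then show ?thesis using assms(2,3) unfolding bin_support_def by auto
  qed
  then show ?thesis by auto
qed

lemma card_bin_support:
  assumes "card (UNIV :: 'a::field set) = 4" and "x \<in> carrier_vec n"
  shows "card (bin_support (x :: 'a vec)) = 2 * hamming_dist x (0\<^sub>v n)"
proof -
  have fin: "finite (UNIV :: 'a set)" using assms(1) card.infinite by fastforce
  let ?I = "{i. i < n \<and> x $ i \<noteq> 0}"
  \<comment> \<open>A nonzero \<open>x $ i\<close> lies outside \<open>{0, s}\<close> exactly for
    the two nonzero \<open>s\<close> different from it.\<close>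
  have "bin_support x = Sigma ?I (\<lambda>i. UNIV - {0, x $ i})"
    using assms(2) unfolding bin_support_def by auto
  moreover have "card (UNIV - {0, x $ i}) = 2" if "i \<in> ?I" for i
    using that assms(1) fin by (subst card_Diff_subset) auto
  moreover have "hamming_dist x (0\<^sub>v n) = card ?I"
    using assms(2) unfolding hamming_dist_def by (intro arg_cong[of _ _ card]) auto
  ultimately show ?thesis by (subst \<open>bin_support x = _\<close>, subst card_SigmaI) (auto simp: fin)
qed

section \<open>The Griesmer bound for additive quaternary codes\<close>

lemma hamming_dist_le:
  assumes "x \<in> carrier_vec n"
  shows "hamming_dist x y \<le> n"
proof -
  have "hamming_dist x y \<le> card {..<n}"
    unfolding hamming_dist_def using assms by (intro card_mono) auto
  then show ?thesis by simp
qed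

lemma finite_distances:
  assumes "C \<subseteq> carrier_vec n"
  shows "finite {hamming_dist x y | x y. x \<in> C \<and> y \<in> C \<and> x \<noteq> y}"
proof (rule finite_subset)
  show "{hamming_dist x y | x y. x \<in> C \<and> y \<in> C \<and> x \<noteq> y} \<subseteq> {..n}"
    using assms hamming_dist_le by (auto simp: subset_iff)
qed simp

lemma additive_griesmer_bound:
  fixes C :: "'a::field vec set"
  assumes q: "card (UNIV :: 'a set) = 4" and "block_code n C" "additive_code C" "card C = 2 ^ m"
  shows "griesmer_sum m (2 * min_dist C) \<le> 3 * int n"
proof -
  have C: "C \<subseteq> carrier_vec n" using assms(2) by (simp add: block_code_def)
  have add: "x + y \<in> C" if "x \<in> C" "y \<in> C" for x y
    using assms(3) that by (auto simp: additive_code_def)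
  have fin: "finite (UNIV :: 'a set)" using q card.infinite by fastforce
  have self: "x + x = 0\<^sub>v n" if "x \<in> C" for x
    using that C char_two_if_card_four[OF q] by (intro eq_vecI) auto
  have "C \<noteq> {}" using assms(4) by auto
  \<comment> \<open>Closure under sums suffices: in characteristic 2 the zero word is
    \<open>x + x\<close>.\<close>
  then have zero: "0\<^sub>v n \<in> C" using self add by (metis all_not_in_conv)
  have wt: "2 * min_dist C \<le> card (bin_support x)" if "x \<in> C" "x \<noteq> 0\<^sub>v n" for x
  proof -
    have "min_dist C \<le> hamming_dist x (0\<^sub>v n)"
      unfolding min_dist_def using finite_distances[OF C] that zero by (intro Min_le) auto
    then show ?thesis using card_bin_support[OF q, of x n] that C by auto
  qed
  have supp0: "bin_support (0\<^sub>v n :: 'a vec) = {}"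
    by (auto simp: bin_support_def)
  have inj: "inj_on bin_support C"
  proof
    fix x y assume xy: "x \<in> C" "y \<in> C" "bin_support x = bin_support y"
    have xc: "x \<in> carrier_vec n" "y \<in> carrier_vec n" using xy C by auto
    have "bin_support (x + y) = {}"
      using bin_support_add[OF q xc] xy by auto
    then have "card (bin_support (x + y)) = 0" by simp
    then have h: "hamming_dist (x + y) (0\<^sub>v n) = 0"
      using card_bin_support[OF q, of "x + y" n] xc by auto
    have "x $ i = y $ i" if "i < n" for i
    proof -
      have "(x + y) $ i = 0" using h that xc by (auto simp: hamming_dist_def)
      then have "x $ i + y $ i = 0" using that xc by simp
      then show ?thesis using char_two_if_card_four[OF q, of "y $ i"] by (metis add_right_cancel)
    qed
    then show "x = y" using xc by (intro eq_vecI) auto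
  qed
  have "griesmer_sum m (2 * min_dist C) \<le> int (card ({..<n} \<times> (UNIV - {0::'a})))"
  proof (rule griesmer_bound)
    show "bin_support ` C \<subseteq> Pow ({..<n} \<times> (UNIV - {0}))"
      using C by (auto simp: bin_support_def)
    show "sym_diff x y \<in> bin_support ` C" if xy: "x \<in> bin_support ` C" "y \<in> bin_support ` C" for x y
    proof -
      obtain x' y' where x': "x' \<in> C" "y' \<in> C" "x = bin_support x'" "y = bin_support y'"
        using xy by blast
      then have "sym_diff x y = bin_support (x' + y')" using bin_support_add[OF q, of x' n y'] C by auto
      then show ?thesis using add x' by blast
    qed
    show "card (bin_support ` C) = 2 ^ m" using card_image[OF inj] assms(4) by simp
    show "2 * min_dist C \<le> card x" if "x \<in> bin_support ` C" "x \<noteq> {}" for x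
      using that wt supp0 by auto
  qed (use fin in auto)
  also have "card ({..<n} \<times> (UNIV - {0::'a})) = 3 * n"
    using q fin by (simp add: card_cartesian_product card_Diff_subset)
  finally show ?thesis by simp
qed

section \<open>Lines in a binary projective space\<close>

text \<open>\<open>J\<close> is the set of binary digits of \<open>e\<close>. The ceilings subtract
  the floors of e / 2^i, which add up over the digits without carry; digit \<open>j\<close> costs
  2^j + ... + 2 + 1. The induction strips the lowest digit.\<close>

lemma griesmer_sum_power_diff:
  assumes "e < 2 ^ k"
  shows "\<exists>J. J \<subseteq> {..<k} \<and> e = (\<Sum>j\<in>J. 2 ^ j) \<and> (\<forall>\<sigma>\<ge>1.
    griesmer_sum (Suc k) (\<sigma> * 2 ^ k - e) = int \<sigma> * (2 ^ Suc k - 1) - (\<Sum>j\<in>J. 2 ^ Suc j - 1))"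
  using assms
proof (induction k arbitrary: e)
  case 0
  then show ?case by (auto simp: griesmer_sum_def)
next
  case (Suc k)
  have "e div 2 < 2 ^ k" using Suc.prems by simp
  from Suc.IH[OF this] obtain J where J: "J \<subseteq> {..<k}" "e div 2 = (\<Sum>j\<in>J. 2 ^ j)" and
    IH: "\<And>\<sigma>. \<sigma> \<ge> 1 \<Longrightarrow> griesmer_sum (Suc k) (\<sigma> * 2 ^ k - e div 2) =
      int \<sigma> * (2 ^ Suc k - 1) - (\<Sum>j\<in>J. 2 ^ Suc j - 1)" by blast
  let ?B = "if odd e then {0::nat} else {}"
  let ?J = "?B \<union> Suc ` J"
  have fin: "finite J" using J(1) finite_subset by blast
  have split: "sum f ?J = (if odd e then f 0 else 0) + (\<Sum>j\<in>J. f (Suc j))" for f :: "nat \<Rightarrow> 'b::comm_monoid_add"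
    using fin by (subst sum.union_disjoint) (auto simp: sum.reindex)
  have esum: "e = (\<Sum>j\<in>?J. 2 ^ j)"
    unfolding split using J(2) by (auto simp flip: sum_distrib_left) presburger+
  have "griesmer_sum (Suc (Suc k)) (\<sigma> * 2 ^ Suc k - e) =
      int \<sigma> * (2 ^ Suc (Suc k) - 1) - (\<Sum>j\<in>?J. 2 ^ Suc j - 1)" if "\<sigma> \<ge> 1" for \<sigma>
  proof -
    have "e \<le> \<sigma> * 2 ^ Suc k"
      using Suc.prems that by (metis less_or_eq_imp_le mult_le_mono1 nat_mult_1 order_trans)
    have "(2 * q - e + 1) div 2 = q - e div 2" if "e \<le> 2 * q" for q
      using that by linarith
    from this[of "\<sigma> * 2 ^ k"] have half: "(\<sigma> * 2 ^ Suc k - e + 1) div 2 = \<sigma> * 2 ^ k - e div 2"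
      using \<open>e \<le> \<sigma> * 2 ^ Suc k\<close> by (simp add: mult.left_commute)
    have "int (\<sigma> * 2 ^ Suc k - e) = 2 * (int \<sigma> * 2 ^ k) - int e"
      using \<open>e \<le> \<sigma> * 2 ^ Suc k\<close> by (simp add: of_nat_diff)
    moreover have "int e = (\<Sum>j\<in>?J. 2 ^ j)" using arg_cong[OF esum, of int] by simp
    ultimately show ?thesis
      unfolding griesmer_sum_Suc[of "Suc k"] half IH[OF that] split
      by (cases "even e") (simp_all add: sum_subtractf algebra_simps flip: sum_distrib_left)
  qed
  moreover have "?J \<subseteq> {..<Suc k}" using J(1) by auto
  ultimately show ?case using esum by blast
qed

lemma odd_card_sym_diff:
  assumes "finite A" "finite B"
  shows "odd (card (sym_diff A B)) \<longleftrightarrow> odd (card A) \<noteq> odd (card B)"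
proof -
  have "card A + card (sym_diff A B) = 2 * card (A - B) + card B"
    by (rule card_sym_diff_add[OF assms])
  then show ?thesis by presburger
qed

text \<open>A nonzero functional takes both values equally often: toggling an element of
  \<open>u\<close> in \<open>X\<close> is an involution that flips the parity.\<close>

lemma card_odd_Int_subsets:
  assumes "finite X" "finite u" "u \<inter> X \<noteq> {}"
  shows "2 * card {x \<in> Pow X. odd (card (u \<inter> x))} = 2 ^ card X"
    and "2 * card {x \<in> Pow X. even (card (u \<inter> x))} = 2 ^ card X"
proof -
  obtain a where a: "a \<in> u" "a \<in> X" using assms(3) by blast
  let ?O = "{x \<in> Pow X. odd (card (u \<inter> x))}" and ?E = "{x \<in> Pow X. even (card (u \<inter> x))}"
  define h where "h x = sym_diff x {a}" for x
  have flip: "even (card (u \<inter> h x)) \<longleftrightarrow> odd (card (u \<inter> x))" for x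
  proof -
    have "u \<inter> h x = sym_diff (u \<inter> x) {a}" unfolding h_def using a by blast
    then show ?thesis using odd_card_sym_diff[of "u \<inter> x" "{a}"] assms(2) by auto
  qed
  have h: "h (h x) = x" "h x \<subseteq> X \<longleftrightarrow> x \<subseteq> X" for x unfolding h_def using a by blast+
  have "bij_betw h ?O ?E"
    by (rule bij_betwI[of _ _ _ h]) (simp_all add: flip h Pi_def)
  then have "card ?O = card ?E" by (rule bij_betw_same_card)
  moreover have "card ?O + card ?E = card (Pow X)"
    using assms(1) by (subst card_Un_disjoint[symmetric]) (auto intro: arg_cong[of _ _ card])
  ultimately show "2 * card ?O = 2 ^ card X" "2 * card ?E = 2 ^ card X"
    using assms(1) by (simp_all add: card_Pow)
qed

text \<open>Subsets of \<open>{..<m}\<close> are the vectors of the binary \<open>m\<close>-space, and a set \<open>u\<close> also acts as the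
  functional \<open>x \<mapsto> card (u \<inter> x)\<close> modulo 2. A pair \<open>(x, y)\<close> stands for the span of \<open>x\<close> and \<open>y\<close>, a line or
  less; it contributes to the weight of \<open>u\<close> unless \<open>u\<close> vanishes on the span.\<close>

definition pair_weight :: "nat set \<Rightarrow> nat set \<times> nat set \<Rightarrow> int" where
  "pair_weight u p = of_bool (odd (card (u \<inter> fst p)) \<or> odd (card (u \<inter> snd p)))"

lemma sum_pair_weight:
  "finite P \<Longrightarrow> (\<Sum>p\<in>P. pair_weight u p) =
    int (card {p \<in> P. odd (card (u \<inter> fst p)) \<or> odd (card (u \<inter> snd p))})"
  unfolding pair_weight_def of_bool_def by (subst sum.If_cases) (simp_all add: Int_def)

text \<open>Distinct nonzero binary vectors are independent, so every pair spans a proper line; each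
  line occurs six times, once per ordered pair of its points.\<close>

definition line_pairs :: "nat \<Rightarrow> (nat set \<times> nat set) set" where
  "line_pairs m = Sigma (Pow {..<m} - {{}}) (\<lambda>x. Pow {..<m} - {{}} - {x})"

lemma card_offdiag:
  assumes "finite A" "z \<in> A"
  shows "int (card (Sigma (A - {z}) (\<lambda>x. A - {z} - {x}))) = (int (card A) - 1) * (int (card A) - 2)"
proof -
  have "card A \<noteq> 0" using assms by auto
  have "card (Sigma (A - {z}) (\<lambda>x. A - {z} - {x})) = (card A - 1) * (card A - 1 - 1)"
    using assms by (subst card_SigmaI) simp_all
  then show ?thesis using \<open>card A \<noteq> 0\<close>
    by (cases "card A = 1") (auto simp: of_nat_diff)
qed

lemma card_line_pairs: "int (card (line_pairs m)) = (2 ^ m - 1) * (2 ^ m - 2)"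
  unfolding line_pairs_def by (subst card_offdiag) (simp_all add: card_Pow)

lemma finite_line_pairs: "finite (line_pairs m)"
  unfolding line_pairs_def by auto

text \<open>The pairs of weight 0 are the ordered pairs of distinct nonzero vectors in the kernel of
  \<open>u\<close>, which has 2^m elements.\<close>

lemma sum_pair_weight_line_pairs:
  assumes "u \<subseteq> {..<Suc m}" "u \<noteq> {}"
  shows "(\<Sum>p\<in>line_pairs (Suc m). pair_weight u p) = 3 * 2 ^ m * (2 ^ m - 1)"
proof -
  let ?Z = "{x \<in> Pow {..<Suc m}. even (card (u \<inter> x))}"
  let ?W = "{p \<in> line_pairs (Suc m). odd (card (u \<inter> fst p)) \<or> odd (card (u \<inter> snd p))}"
  let ?N = "Sigma (?Z - {{}}) (\<lambda>x. ?Z - {{}} - {x})"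
  have finZ: "finite ?Z" by simp
  have "finite u" "u \<inter> {..<Suc m} \<noteq> {}" using assms finite_subset by blast+
  then have "card ?Z = 2 ^ m" using card_odd_Int_subsets(2)[of "{..<Suc m}" u] by simp
  then have N: "int (card ?N) = (2 ^ m - 1) * (2 ^ m - 2)"
    using card_offdiag[OF finZ, of "{}"] by simp
  have W: "?W \<subseteq> line_pairs (Suc m)" by blast
  have "?N = line_pairs (Suc m) - ?W"
  proof (rule Set.set_eqI)
    fix p :: "nat set \<times> nat set"
    obtain x y where "p = (x, y)" by (cases p)
    then show "p \<in> ?N \<longleftrightarrow> p \<in> line_pairs (Suc m) - ?W"
      unfolding line_pairs_def by (simp del: Pow_iff) blast
  qed
  then have "card ?N = card (line_pairs (Suc m)) - card ?W"
    using card_Diff_subset[OF finite_subset[OF W finite_line_pairs] W] by simp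
  moreover have "card ?W \<le> card (line_pairs (Suc m))"
    by (rule card_mono[OF finite_line_pairs W])
  ultimately have "card (line_pairs (Suc m)) = card ?W + card ?N" by simp
  then have "int (card ?W) = (2 ^ Suc m - 1) * (2 ^ Suc m - 2) - (2 ^ m - 1) * (2 ^ m - 2)"
    using N card_line_pairs[of "Suc m"] by linarith
  then show ?thesis
    unfolding sum_pair_weight[OF finite_line_pairs] by (simp add: algebra_simps)
qed

text \<open>The lines through the point \<open>{0}\<close> in the subspace \<open>Pow {..<j + 2}\<close>.\<close>

definition star :: "nat \<Rightarrow> (nat set \<times> nat set) set" where
  "star j = {{0}} \<times> (Pow {1..<j + 2} - {{}})"

lemma finite_star: "finite (star j)"
  unfolding star_def by auto

lemma card_star: "int (card (star j)) = 2 ^ Suc j - 1"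
  unfolding star_def by (simp add: card_cartesian_product card_Diff_subset card_Pow of_nat_diff)

text \<open>A line weighs half the number of its points on which \<open>u\<close> is odd. The star
  covers its subspace once and \<open>{0}\<close> another 2^(j+1) - 2 times; the last summand is
  this excess.\<close>

lemma sum_pair_weight_star:
  assumes "finite u"
  shows "(\<Sum>p\<in>star j. pair_weight u p) =
    2 ^ j * of_bool (u \<inter> {..<j + 2} \<noteq> {}) + (2 ^ j - 1) * of_bool (0 \<in> u)"
proof (cases "0 \<in> u")
  case True
  then have "{p \<in> star j. odd (card (u \<inter> fst p)) \<or> odd (card (u \<inter> snd p))} = star j"
    by (auto simp: star_def)
  then show ?thesis
    using True sum_pair_weight[OF finite_star] card_star[of j] by (auto simp: of_bool_def)
next
  case False
  let ?O = "{y \<in> Pow {1..<j + 2}. odd (card (u \<inter> y))}"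
  have "{p \<in> star j. odd (card (u \<inter> fst p)) \<or> odd (card (u \<inter> snd p))} = {{0}} \<times> ?O"
    using False by (auto simp: star_def)
  then have sum: "(\<Sum>p\<in>star j. pair_weight u p) = int (card ?O)"
    using sum_pair_weight[OF finite_star] by (simp add: card_cartesian_product)
  have "{..<j + 2} = insert 0 {1..<j + 2}" by auto
  then have meet: "u \<inter> {..<j + 2} = u \<inter> {1..<j + 2}" using False by simp
  show ?thesis
  proof (cases "u \<inter> {1..<j + 2} = {}")
    case True
    have "u \<inter> y = {}" if "y \<subseteq> {1..<j + 2}" for y using that True by blast
    then have "?O = {}" by auto
    then show ?thesis using sum meet True False by simp
  next
    case nonempty: False
    then have "card ?O = 2 ^ j" using card_odd_Int_subsets(1)[of "{1..<j + 2}" u] assms by simp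
    then show ?thesis using sum meet nonempty False by simp
  qed
qed

text \<open>With \<open>a = {0}\<close>, \<open>b = {1}\<close>, \<open>c = {2}\<close>, the following integral combination of lines of a plane
  covers \<open>a\<close> six times and no other point. It adds up
  \<open>2 {a, b, a + b}\<close>, \<open>2 a - 2 b\<close> and \<open>2 a - 2 (a + b)\<close>, each difference \<open>2 x - 2 z\<close> being
  \<open>(x, y + z) + (x, y) - (z, x + y) - (z, y)\<close>.\<close>

definition sixfold_point :: "nat set \<times> nat set \<Rightarrow> int" where
  "sixfold_point p = 2 * of_bool (p = ({0}, {1})) + of_bool (p = ({0}, {1, 2}))
    + 2 * of_bool (p = ({0}, {2})) + of_bool (p = ({0}, {0, 1, 2}))
    - of_bool (p = ({1}, {0, 2})) - of_bool (p = ({1}, {2}))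
    - of_bool (p = ({0, 1}, {0, 2})) - of_bool (p = ({0, 1}, {2}))"

lemma sum_of_bool_eq_mult:
  "finite U \<Longrightarrow> a \<in> U \<Longrightarrow> (\<Sum>p\<in>U. of_bool (p = a) * f p) = (f a :: int)"
  by (simp add: of_bool_def if_distrib[of "\<lambda>x. x * _"] sum.delta cong: if_cong)

lemma sum_of_bool_mem_mult:
  assumes "finite U" "B \<subseteq> U"
  shows "(\<Sum>p\<in>U. of_bool (p \<in> B) * f p) = (\<Sum>p\<in>B. f p :: int)"
proof -
  have "(\<Sum>p\<in>B. f p) = (\<Sum>p\<in>U. if p \<in> B then f p else 0)"
    using assms by (simp add: sum.inter_restrict[symmetric] Int_absorb1)
  then show ?thesis by (simp add: of_bool_def if_distrib[of "\<lambda>x. x * _"] cong: if_cong)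
qed

lemma sum_sixfold_point_mult:
  assumes "finite U" "Pow {..<3} \<times> Pow {..<3} \<subseteq> U"
  shows "(\<Sum>p\<in>U. sixfold_point p * f p) =
    2 * f ({0}, {1}) + f ({0}, {1, 2}) + 2 * f ({0}, {2}) + f ({0}, {0, 1, 2})
    - f ({1}, {0, 2}) - f ({1}, {2}) - f ({0, 1}, {0, 2}) - f ({0, 1}, {2})"
proof -
  have "a \<in> U" if "fst a \<subseteq> {..<3}" "snd a \<subseteq> {..<3}" for a
    using that assms(2) by (cases a) auto
  then show ?thesis
    unfolding sixfold_point_def distrib_right left_diff_distrib sum.distrib sum_subtractf mult.assoc
      sum_distrib_left[symmetric]
    by (simp add: sum_of_bool_eq_mult[OF assms(1)])
qed

lemma sum_sixfold_point:
  assumes "finite U" "Pow {..<3} \<times> Pow {..<3} \<subseteq> U"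
  shows "(\<Sum>p\<in>U. sixfold_point p) = 2"
  using sum_sixfold_point_mult[OF assms, of "\<lambda>_. 1"] by simp

text \<open>Six copies of \<open>{0}\<close> weigh 3, as every point counts one half.\<close>

lemma sum_sixfold_point_pair_weight:
  assumes "finite U" "Pow {..<3} \<times> Pow {..<3} \<subseteq> U" "finite u"
  shows "(\<Sum>p\<in>U. sixfold_point p * pair_weight u p) = 3 * of_bool (0 \<in> u)"
  unfolding sum_sixfold_point_mult[OF assms(1,2)] pair_weight_def
  by (cases "0 \<in> u"; cases "1 \<in> u"; cases "2 \<in> u") (auto simp: Int_insert_right)

lemma abs_sixfold_point_le: "\<bar>sixfold_point p\<bar> \<le> 2"
  unfolding sixfold_point_def by (cases p) (auto simp: of_bool_def)

lemma sixfold_point_outside: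
  assumes "3 \<le> m" "p \<notin> line_pairs m"
  shows "sixfold_point p = 0"
proof -
  have sub: "{0, 1, 2} \<subseteq> {..<m}" using assms(1) by auto
  \<comment> \<open>\<open>i\<close> and \<open>j\<close> witness that the vectors are nonzero,
    \<open>l\<close> that they differ.\<close>
  have "p \<noteq> (x, y)" if "i \<in> x" "j \<in> y" "(l \<in> x) \<noteq> (l \<in> y)" "x \<subseteq> {0, 1, 2}" "y \<subseteq> {0, 1, 2}"
    for x y i j l
    using that sub assms(2) unfolding line_pairs_def by blast
  from this[of 0 "{0}" 1 "{1}" 0] this[of 0 "{0}" 1 "{1, 2}" 0] this[of 0 "{0}" 2 "{2}" 0]
    this[of 0 "{0}" 0 "{0, 1, 2}" 2] this[of 1 "{1}" 0 "{0, 2}" 2] this[of 1 "{1}" 2 "{2}" 2]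
    this[of 0 "{0, 1}" 0 "{0, 2}" 2] this[of 0 "{0, 1}" 2 "{2}" 2]
  show ?thesis unfolding sixfold_point_def by simp
qed

section \<open>Optimal arrangements as nonnegative combinations of lines\<close>

lemma exists_list_with_multiplicities:
  fixes c :: "'b \<Rightarrow> int"
  assumes "finite U" "\<And>p. p \<in> U \<Longrightarrow> 0 \<le> c p"
  shows "\<exists>xs. \<forall>f :: 'b \<Rightarrow> int. sum_list (map f xs) = (\<Sum>p\<in>U. c p * f p)"
  using assms
proof (induction U)
  case empty
  then show ?case by (intro exI[of _ "[]"]) simp
next
  case (insert p U)
  then obtain xs where "\<forall>f :: 'b \<Rightarrow> int. sum_list (map f xs) = (\<Sum>p\<in>U. c p * f p)" by auto
  then show ?case using insert
    by (intro exI[of _ "replicate (nat (c p)) p @ xs"]) (simp add: sum_list_replicate)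
qed

lemma star_mono: "j \<le> k \<Longrightarrow> star j \<subseteq> star k"
  unfolding star_def by (intro Sigma_mono Diff_mono Pow_mono) auto

text \<open>\<open>line_pairs (k + 2)\<close> covers each nonzero vector
  \<open>3 * (2 ^ (k + 2) - 2)\<close> times, so \<open>t\<close> copies leave \<open>s\<close>
  copies of the space to be supplied by stars. \<open>k \<le> s\<close> keeps the star coefficients
  nonnegative; the bound on \<open>t\<close> compensates the sixfold points.\<close>

lemma exists_arrangement:
  assumes k: "k \<ge> 1" and J: "J \<subseteq> {..<k}" and s: "k \<le> s" and t: "2 * s * 2 ^ k \<le> t"
    and sigma: "\<sigma> = s + 3 * (2 ^ (k + 2) - 2) * t"
  shows "\<exists>xs. 3 * int (length xs) \<le> int \<sigma> * (2 ^ (k + 2) - 1) - (\<Sum>j\<in>J. 2 ^ (j + 2) - 1) + 2 \<and>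
    (\<forall>u. u \<subseteq> {..<k + 2} \<longrightarrow> u \<noteq> {} \<longrightarrow> sum_list (map (pair_weight u) xs) =
      int \<sigma> * 2 ^ k - (\<Sum>j\<in>J. 2 ^ j * of_bool (u \<inter> {..<j + 2} \<noteq> {})))"
proof -
  define U :: "(nat set \<times> nat set) set" where "U = Pow {..<k + 2} \<times> Pow {..<k + 2}"
  \<comment> \<open>The excess weight that the combination of stars puts on
    \<open>{0}\<close>.\<close>
  define D :: int where "D = int s * (2 ^ k - 1) - (\<Sum>j\<in>J. 2 ^ j - 1)"
  \<comment> \<open>\<open>q\<close> is D / 3 rounded up: removing \<open>q\<close> sixfold points
    lowers the weight at \<open>{0}\<close> by \<open>3 * q\<close>, and \<open>r\<close> degenerate
    lines \<open>({0}, {})\<close> of weight 1 restore the overshoot.\<close>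
  define q where "q = (D + 2) div 3"
  define r where "r = 3 * q - D"
  have r: "0 \<le> r" "r \<le> 2" unfolding r_def q_def by presburger+
  have finJ: "finite J" using J finite_subset by blast
  have cardJ: "card J \<le> k" using J card_mono[of "{..<k}" J] by simp
  have sigma': "int \<sigma> = int s + 3 * (2 ^ (k + 2) - 2) * int t"
    unfolding sigma by (simp add: of_nat_diff)
  have "(\<Sum>j\<in>J. 2 ^ j - 1 :: int) \<le> (\<Sum>j\<in>J. 2 ^ k - 1)"
    using J by (intro sum_mono diff_right_mono power_increasing) auto
  also have "\<dots> \<le> int s * (2 ^ k - 1)"
    using cardJ s by (simp add: mult_right_mono)
  finally have D0: "0 \<le> D" unfolding D_def by simp
  have "0 \<le> (\<Sum>j\<in>J. 2 ^ j - 1 :: int)" by (intro sum_nonneg) simp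
  then have "D \<le> int s * 2 ^ k" unfolding D_def by (simp add: algebra_simps)
  moreover have "2 * (int s * 2 ^ k) \<le> int t" using t
    by (metis (mono_tags) mult.assoc of_nat_le_iff of_nat_mult of_nat_numeral of_nat_power)
  ultimately have tD: "2 * D \<le> int t" by linarith
  have "q \<le> D" using D0 unfolding q_def by linarith
  then have q: "0 \<le> q" "2 * q \<le> int t" using D0 tD unfolding q_def by linarith+
  define c where "c p = int t * of_bool (p \<in> line_pairs (k + 2))
    + (int s * of_bool (p \<in> star k) - (\<Sum>j\<in>J. of_bool (p \<in> star j)))
    - q * sixfold_point p + r * of_bool (p = ({0}, {}))" for p
  have "0 \<le> c p" for p
  proof -
    have "star j \<subseteq> star k" if "j \<in> J" for j
      using that J by (intro star_mono) auto
    then have "(\<Sum>j\<in>J. of_bool (p \<in> star j) :: int) \<le> (\<Sum>j\<in>J. of_bool (p \<in> star k))"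
      by (intro sum_mono) auto
    also have "\<dots> \<le> int s * of_bool (p \<in> star k)"
      using cardJ s by simp
    finally have 1: "0 \<le> int s * of_bool (p \<in> star k) - (\<Sum>j\<in>J. of_bool (p \<in> star j))" by simp
    have 2: "q * sixfold_point p \<le> int t * of_bool (p \<in> line_pairs (k + 2))"
    proof (cases "p \<in> line_pairs (k + 2)")
      case True
      have "q * sixfold_point p \<le> q * 2"
        using abs_sixfold_point_le[of p] q(1) by (intro mult_left_mono) auto
      then show ?thesis using True q(2) by simp
    next
      case False
      then show ?thesis using sixfold_point_outside[of "k + 2" p] k by simp
    qed
    have "0 \<le> r * of_bool (p = ({0}, {}))" using r by simp
    then show ?thesis unfolding c_def using 1 2 by linarith
  qed
  moreover have finU: "finite U" unfolding U_def by simp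
  ultimately obtain xs where xs: "\<And>f :: _ \<Rightarrow> int. sum_list (map f xs) = (\<Sum>p\<in>U. c p * f p)"
    using exists_list_with_multiplicities[of U c] by blast
  have subU: "line_pairs (k + 2) \<subseteq> U" "star k \<subseteq> U" "({0}, {}) \<in> U" "Pow {..<3} \<times> Pow {..<3} \<subseteq> U"
    using k unfolding U_def line_pairs_def star_def by (auto simp: subset_iff)
  have starU: "star j \<subseteq> U" if "j \<in> J" for j
    using that J star_mono[of j k] subU(2) by fastforce
  have total: "sum_list (map f xs) = int t * (\<Sum>p\<in>line_pairs (k + 2). f p)
    + int s * (\<Sum>p\<in>star k. f p) - (\<Sum>j\<in>J. \<Sum>p\<in>star j. f p)
    - q * (\<Sum>p\<in>U. sixfold_point p * f p) + r * f ({0}, {})" for f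
  proof -
    have "(\<Sum>p\<in>U. (\<Sum>j\<in>J. of_bool (p \<in> star j)) * f p) = (\<Sum>j\<in>J. \<Sum>p\<in>U. of_bool (p \<in> star j) * f p)"
      by (subst sum.swap) (simp add: sum_distrib_right)
    also have "\<dots> = (\<Sum>j\<in>J. \<Sum>p\<in>star j. f p)"
      by (intro sum.cong refl sum_of_bool_mem_mult finU starU)
    finally show ?thesis
      unfolding xs c_def distrib_right left_diff_distrib sum.distrib sum_subtractf mult.assoc
        sum_distrib_left[symmetric]
      using sum_of_bool_mem_mult[OF finU subU(1)] sum_of_bool_mem_mult[OF finU subU(2)]
        sum_of_bool_eq_mult[OF finU subU(3)] by simp
  qed
  have rq: "3 * q = D + r" unfolding r_def by simp
  have rounding: "3 * L = 3 * X - 2 * D + r" if "L = X - q * 2 + r" for L X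
    using that rq by linarith
  have "int (length xs) = sum_list (map (\<lambda>_. 1) xs)" by (simp add: sum_list_triv)
  also have "\<dots> = int t * ((2 ^ (k + 2) - 1) * (2 ^ (k + 2) - 2)) + int s * (2 ^ Suc k - 1)
      - (\<Sum>j\<in>J. 2 ^ Suc j - 1) - q * 2 + r"
    unfolding total using sum_sixfold_point[OF finU subU(4)] card_line_pairs[of "k + 2"] card_star by simp
  finally have "int (length xs) = (int t * ((2 ^ (k + 2) - 1) * (2 ^ (k + 2) - 2)) + int s * (2 ^ Suc k - 1)
      - (\<Sum>j\<in>J. 2 ^ Suc j - 1)) - q * 2 + r" .
  then have "3 * int (length xs) = 3 * (int t * ((2 ^ (k + 2) - 1) * (2 ^ (k + 2) - 2)) + int s * (2 ^ Suc k - 1)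
      - (\<Sum>j\<in>J. 2 ^ Suc j - 1)) - 2 * D + r" by (rule rounding)
  \<comment> \<open>Three times the length counts points, except that each of the \<open>r\<close>
    degenerate lines stands for only two; hence the surplus \<open>r\<close>.\<close>
  also have "\<dots> = int \<sigma> * (2 ^ (k + 2) - 1) - (\<Sum>j\<in>J. 2 ^ (j + 2) - 1) + r"
    unfolding D_def sigma' by (simp add: sum_subtractf algebra_simps flip: sum_distrib_left)
  finally have len: "3 * int (length xs) \<le> int \<sigma> * (2 ^ (k + 2) - 1) - (\<Sum>j\<in>J. 2 ^ (j + 2) - 1) + 2"
    using r by simp
  have "sum_list (map (pair_weight u) xs) =
      int \<sigma> * 2 ^ k - (\<Sum>j\<in>J. 2 ^ j * of_bool (u \<inter> {..<j + 2} \<noteq> {}))"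
    if u: "u \<subseteq> {..<k + 2}" "u \<noteq> {}" for u
  proof -
    define a :: int where "a = of_bool (0 \<in> u)"
    have finu: "finite u" using u finite_subset by blast
    have lines: "(\<Sum>p\<in>line_pairs (k + 2). pair_weight u p) = 3 * 2 ^ Suc k * (2 ^ Suc k - 1)"
      using sum_pair_weight_line_pairs[of u "Suc k"] u by simp
    have point: "pair_weight u ({0}, {}) = a"
      unfolding pair_weight_def a_def by simp
    have "u \<inter> {..<k + 2} \<noteq> {}" using u by blast
    then have stark: "(\<Sum>p\<in>star k. pair_weight u p) = 2 ^ k + (2 ^ k - 1) * a"
      unfolding sum_pair_weight_star[OF finu] a_def by simp
    have starJ: "(\<Sum>j\<in>J. \<Sum>p\<in>star j. pair_weight u p) =
        (\<Sum>j\<in>J. 2 ^ j * of_bool (u \<inter> {..<j + 2} \<noteq> {})) + (\<Sum>j\<in>J. 2 ^ j - 1) * a"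
      unfolding sum_pair_weight_star[OF finu] a_def by (simp add: sum.distrib sum_distrib_right)
    \<comment> \<open>The coefficient of \<open>a\<close> collects \<open>D\<close> from the stars,
      \<open>r\<close> from the degenerate lines and \<open>- 3 * q\<close> from the sixfold points,
      and so vanishes.\<close>
    have "sum_list (map (pair_weight u) xs) = int t * (3 * 2 ^ Suc k * (2 ^ Suc k - 1)) + int s * 2 ^ k
        - (\<Sum>j\<in>J. 2 ^ j * of_bool (u \<inter> {..<j + 2} \<noteq> {})) + (D + r - 3 * q) * a"
      unfolding total lines stark starJ point sum_sixfold_point_pair_weight[OF finU subU(4) finu]
        a_def[symmetric] D_def by (simp add: algebra_simps)
    then show ?thesis unfolding rq sigma' by (simp add: algebra_simps)
  qed
  then show ?thesis using len by blast
qed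

lemma exists_optimal_arrangement:
  assumes k: "k \<ge> 1" and \<Lambda>: "\<Lambda> = 3 * (2 ^ (k + 2) - 2)"
    and d: "2 ^ k * (k + \<Lambda> * (2 * (k + \<Lambda>) * 2 ^ k)) \<le> d" and "d \<ge> 1"
  shows "\<exists>xs. 3 * int (length xs) \<le> griesmer_sum (k + 2) (2 * d) + 2 \<and>
    (\<forall>u. u \<subseteq> {..<k + 2} \<longrightarrow> u \<noteq> {} \<longrightarrow> int d \<le> sum_list (map (pair_weight u) xs)) \<and>
    sum_list (map (pair_weight {1}) xs) = int d"
proof -
  \<comment> \<open>d / 2^k rounded up, so that the defect \<open>e\<close> is below
    \<open>2 ^ k\<close>.\<close>
  define \<sigma> where "\<sigma> = (d + (2 ^ k - 1)) div 2 ^ k"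
  define e where "e = \<sigma> * 2 ^ k - d"
  have pos: "(0::nat) < 2 ^ k" by simp
  have "\<sigma> * 2 ^ k + (d + (2 ^ k - 1)) mod 2 ^ k = d + (2 ^ k - 1)"
    unfolding \<sigma>_def by (rule div_mult_mod_eq)
  moreover have "(d + (2 ^ k - 1)) mod 2 ^ k < 2 ^ k" by simp
  ultimately have sd: "d \<le> \<sigma> * 2 ^ k" "\<sigma> * 2 ^ k < d + 2 ^ k" using pos by linarith+
  then have "e < 2 ^ k" and de: "d = \<sigma> * 2 ^ k - e" "e \<le> \<sigma> * 2 ^ k" unfolding e_def using \<open>d \<ge> 1\<close> by linarith+
  from griesmer_sum_power_diff[OF this(1)] obtain J where
    J: "J \<subseteq> {..<k}" "e = (\<Sum>j\<in>J. 2 ^ j)" and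
    g: "\<And>\<sigma>. \<sigma> \<ge> 1 \<Longrightarrow> griesmer_sum (Suc k) (\<sigma> * 2 ^ k - e) =
      int \<sigma> * (2 ^ Suc k - 1) - (\<Sum>j\<in>J. 2 ^ Suc j - 1)" by blast
  have "\<sigma> \<ge> 1" using sd(1) \<open>d \<ge> 1\<close> by (cases "\<sigma> = 0") auto
  have int_d: "int d = int \<sigma> * 2 ^ k - (\<Sum>j\<in>J. 2 ^ j)"
    using de J(2) by (simp add: of_nat_diff)
  have "griesmer_sum (k + 2) (2 * d) = 2 * int d + griesmer_sum (Suc k) d"
    using griesmer_sum_Suc[of "Suc k" "2 * d"] by simp
  also have "griesmer_sum (Suc k) d = int \<sigma> * (2 ^ Suc k - 1) - (\<Sum>j\<in>J. 2 ^ Suc j - 1)"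
    using g[OF \<open>\<sigma> \<ge> 1\<close>] de(1) by simp
  finally have gs: "griesmer_sum (k + 2) (2 * d) = int \<sigma> * (2 ^ (k + 2) - 1) - (\<Sum>j\<in>J. 2 ^ (j + 2) - 1)"
    unfolding int_d by (simp add: sum_subtractf algebra_simps flip: sum_distrib_left)
  have "2 ^ k * (k + \<Lambda> * (2 * (k + \<Lambda>) * 2 ^ k)) \<le> 2 ^ k * \<sigma>"
    using order_trans[OF d sd(1)] by (simp only: mult.commute[of \<sigma>])
  then have \<sigma>_ge: "k + \<Lambda> * (2 * (k + \<Lambda>) * 2 ^ k) \<le> \<sigma>"
    by (rule mult_left_le_imp_le) simp
  have "(1::nat) < 2 * 2 ^ k" using pos by linarith
  then have "0 < \<Lambda>" unfolding \<Lambda> by simp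
  \<comment> \<open>Division of \<open>\<sigma> - k\<close> by \<open>\<Lambda>\<close>, shifted to
    ensure \<open>k \<le> s \<le> k + \<Lambda>\<close>. The threshold on \<open>d\<close> makes
    \<open>t\<close> large enough for every such \<open>s\<close>.\<close>
  define t where "t = (\<sigma> - k) div \<Lambda>"
  define s where "s = k + (\<sigma> - k) mod \<Lambda>"
  have "s \<le> k + \<Lambda>" unfolding s_def using \<open>0 < \<Lambda>\<close> by (simp add: less_imp_le)
  then have "2 * s * 2 ^ k \<le> 2 * (k + \<Lambda>) * 2 ^ k" by simp
  also have "\<dots> \<le> t"
    unfolding t_def using \<sigma>_ge \<open>0 < \<Lambda>\<close> by (simp add: less_eq_div_iff_mult_less_eq mult.commute)
  finally have "2 * s * 2 ^ k \<le> t" .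
  moreover have "\<sigma> = s + 3 * (2 ^ (k + 2) - 2) * t"
    unfolding s_def t_def \<Lambda>[symmetric] using \<sigma>_ge by simp
  ultimately obtain xs where xs: "3 * int (length xs) \<le> griesmer_sum (k + 2) (2 * d) + 2"
    "\<And>u. u \<subseteq> {..<k + 2} \<Longrightarrow> u \<noteq> {} \<Longrightarrow> sum_list (map (pair_weight u) xs) =
      int \<sigma> * 2 ^ k - (\<Sum>j\<in>J. 2 ^ j * of_bool (u \<inter> {..<j + 2} \<noteq> {}))"
    using exists_arrangement[OF k J(1), of s t \<sigma>] gs unfolding s_def by auto
  have "int d \<le> sum_list (map (pair_weight u) xs)" if "u \<subseteq> {..<k + 2}" "u \<noteq> {}" for u
    unfolding xs(2)[OF that] int_d by (intro diff_left_mono sum_mono) auto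
  \<comment> \<open>\<open>{1}\<close> meets every \<open>{..<j + 2}\<close>, so all deductions
    apply and the weight \<open>d\<close> is attained.\<close>
  moreover have "sum_list (map (pair_weight {1}) xs) = int d"
    using xs(2)[of "{1}"] int_d by simp
  ultimately show ?thesis using xs(1) by blast
qed

section \<open>From line arrangements to additive codes\<close>

text \<open>With 1 and \<open>\<omega>\<close> as a binary basis of the field, a coordinate records
  the values of \<open>u\<close> on the two generators, so it is zero iff \<open>u\<close> vanishes
  on their span.\<close>

definition pair_word :: "'a::field \<Rightarrow> (nat set \<times> nat set) list \<Rightarrow> nat set \<Rightarrow> 'a vec" where
  "pair_word \<omega> ps u = vec (length ps) (\<lambda>i. of_bool (odd (card (u \<inter> fst (ps ! i))))
    + of_bool (odd (card (u \<inter> snd (ps ! i)))) * \<omega>)"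

lemma pair_word_add:
  fixes \<omega> :: "'a::field"
  assumes "card (UNIV :: 'a set) = 4" "finite u" "finite v"
  shows "pair_word \<omega> ps u + pair_word \<omega> ps v = pair_word \<omega> ps (sym_diff u v)"
proof -
  have parity: "odd (card (sym_diff u v \<inter> x)) \<longleftrightarrow> odd (card (u \<inter> x)) \<noteq> odd (card (v \<inter> x))" for x
  proof -
    have "sym_diff u v \<inter> x = sym_diff (u \<inter> x) (v \<inter> x)" by blast
    then show ?thesis using odd_card_sym_diff[of "u \<inter> x" "v \<inter> x"] assms by simp
  qed
  have add: "of_bool P + of_bool P' * \<omega> + (of_bool Q + of_bool Q' * \<omega>) =
      of_bool (P \<noteq> Q) + of_bool (P' \<noteq> Q') * \<omega>" for P P' Q Q'
  proof -
    have "(2::'a) = 0" using char_two_if_card_four[OF assms(1), of 1] by simp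
    then show ?thesis
      by (cases P; cases P'; cases Q; cases Q') (simp_all add: algebra_simps flip: mult_2)
  qed
  show ?thesis
    unfolding pair_word_def by (rule eq_vecI) (simp_all add: parity add del: of_bool_eq_iff)
qed

lemma hamming_dist_pair_word_zero:
  fixes \<omega> :: "'a::field"
  assumes "card (UNIV :: 'a set) = 4" "\<omega> \<noteq> 0" "\<omega> \<noteq> 1"
  shows "int (hamming_dist (pair_word \<omega> ps u) (0\<^sub>v (length ps))) = sum_list (map (pair_weight u) ps)"
proof -
  have "1 + \<omega> \<noteq> 0"
    using char_two_if_card_four[OF assms(1), of 1] assms(3) by (metis add_left_cancel)
  then have nz: "of_bool P + of_bool Q * \<omega> \<noteq> 0 \<longleftrightarrow> P \<or> Q" for P Q
    using assms(2) by (cases P; cases Q) auto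
  have "sum_list (map (pair_weight u) ps) = (\<Sum>i<length ps. pair_weight u (ps ! i))"
    by (simp add: sum_list_sum_nth atLeast0LessThan)
  also have "\<dots> = int (card ({..<length ps} \<inter>
      {i. odd (card (u \<inter> fst (ps ! i))) \<or> odd (card (u \<inter> snd (ps ! i)))}))"
    unfolding pair_weight_def by (rule sum_of_bool_eq) simp_all
  also have "{..<length ps} \<inter> {i. odd (card (u \<inter> fst (ps ! i))) \<or> odd (card (u \<inter> snd (ps ! i)))}
      = {i. i < dim_vec (pair_word \<omega> ps u) \<and> pair_word \<omega> ps u $ i \<noteq> 0\<^sub>v (length ps) $ i}"
  proof (rule Set.set_eqI)
    fix i
    show "i \<in> {..<length ps} \<inter> {i. odd (card (u \<inter> fst (ps ! i))) \<or> odd (card (u \<inter> snd (ps ! i)))} \<longleftrightarrow>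
        i \<in> {i. i < dim_vec (pair_word \<omega> ps u) \<and> pair_word \<omega> ps u $ i \<noteq> 0\<^sub>v (length ps) $ i}"
      using nz[of "odd (card (u \<inter> fst (ps ! i)))" "odd (card (u \<inter> snd (ps ! i)))"]
      by (cases "i < length ps") (simp_all only: pair_word_def mem_Collect_eq Int_iff lessThan_iff
        dim_vec index_vec index_zero_vec simp_thms)
  qed
  finally show ?thesis unfolding hamming_dist_def by simp
qed

lemma hamming_dist_eq_add_zero:
  assumes "card (UNIV :: 'a::field set) = 4" "x \<in> carrier_vec n" "y \<in> carrier_vec n"
  shows "hamming_dist x y = hamming_dist (x + y :: 'a vec) (0\<^sub>v n)"
proof -
  have "z + w = 0 \<longleftrightarrow> z = w" for z w :: 'a
    by (rule add_right_cancel[of z w w, unfolded char_two_if_card_four[OF assms(1)]])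
  then have "(x $ i \<noteq> y $ i) = ((x + y) $ i \<noteq> 0\<^sub>v n $ i)" if "i < n" for i
    using that assms(2,3) by simp
  then have "{i. i < n \<and> x $ i \<noteq> y $ i} = {i. i < n \<and> (x + y) $ i \<noteq> 0\<^sub>v n $ i}"
    by (intro Collect_cong conj_cong refl)
  then show ?thesis unfolding hamming_dist_def using assms(2,3) by simp
qed

lemma exists_additive_code:
  assumes q: "card (UNIV :: 'a::field set) = 4" and "m \<ge> 2" "d \<ge> 1" "length xs \<le> n"
    and wt: "\<And>u. u \<subseteq> {..<m} \<Longrightarrow> u \<noteq> {} \<Longrightarrow> int d \<le> sum_list (map (pair_weight u) xs)"
    and eq: "sum_list (map (pair_weight {1}) xs) = int d"
  shows "\<exists>C :: 'a vec set. block_code n C \<and> additive_code C \<and> card C = 2 ^ m \<and> min_dist C = d"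
proof -
  have "\<not> (UNIV :: 'a set) \<subseteq> {0, 1}" using q card_mono[of "{0, 1::'a}" UNIV] by auto
  then obtain \<omega> :: 'a where \<omega>: "\<omega> \<noteq> 0" "\<omega> \<noteq> 1" by blast
  \<comment> \<open>Padding with \<open>({}, {})\<close> adds zero coordinates, which reaches every
    length \<open>n\<close> without changing weights.\<close>
  define ps where "ps = xs @ replicate (n - length xs) ({}, {})"
  define W where "W = pair_word \<omega> ps"
  let ?C = "W ` Pow {..<m}"
  have len: "length ps = n" unfolding ps_def using assms(4) by simp
  have carr: "W u \<in> carrier_vec n" for u
    unfolding W_def pair_word_def using len by simp
  have "sum_list (map (pair_weight u) ps) = sum_list (map (pair_weight u) xs)" for u
    unfolding ps_def by (simp add: sum_list_replicate pair_weight_def)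
  then have weight: "int (hamming_dist (W u) (0\<^sub>v n)) = sum_list (map (pair_weight u) xs)" for u
    unfolding W_def using hamming_dist_pair_word_zero[OF q \<omega>, of ps u] len by simp
  have add: "W u + W v = W (sym_diff u v)" if "u \<subseteq> {..<m}" "v \<subseteq> {..<m}" for u v
    unfolding W_def using that finite_subset by (intro pair_word_add[OF q]) blast+
  have dist: "int (hamming_dist (W u) (W v)) = sum_list (map (pair_weight (sym_diff u v)) xs)"
    if "u \<subseteq> {..<m}" "v \<subseteq> {..<m}" for u v
    using hamming_dist_eq_add_zero[OF q carr carr, of u v] add[OF that] weight by simp
  have dist_ge: "d \<le> hamming_dist (W u) (W v)" if "u \<subseteq> {..<m}" "v \<subseteq> {..<m}" "u \<noteq> v" for u v
  proof -
    have "int d \<le> sum_list (map (pair_weight (sym_diff u v)) xs)"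
      using that by (intro wt) blast+
    then show ?thesis using dist[OF that(1,2)] by simp
  qed
  have inj: "inj_on W (Pow {..<m})"
  proof
    fix u v assume uv: "u \<in> Pow {..<m}" "v \<in> Pow {..<m}" "W u = W v"
    have "hamming_dist (W u) (W v) = 0" unfolding uv(3) by (simp add: hamming_dist_def)
    then show "u = v" using dist_ge[of u v] uv(1,2) \<open>d \<ge> 1\<close> by fastforce
  qed
  have C: "?C \<subseteq> carrier_vec n" using carr by blast
  have "additive_code ?C"
    unfolding additive_code_def using add by (auto intro!: imageI)
  moreover have "min_dist ?C = d"
    unfolding min_dist_def
  proof (rule Min_eqI[OF finite_distances[OF C]])
    show "d \<le> y" if "y \<in> {hamming_dist x y | x y. x \<in> ?C \<and> y \<in> ?C \<and> x \<noteq> y}" for y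
      using that dist_ge by auto
    have "hamming_dist (W {1}) (W {}) = d" using dist[of "{1}" "{}"] eq \<open>m \<ge> 2\<close> by simp
    moreover have "W {1} \<noteq> W {}" using inj_onD[OF inj, of "{1}" "{}"] \<open>m \<ge> 2\<close> by auto
    moreover have "W {1} \<in> ?C" "W {} \<in> ?C" using \<open>m \<ge> 2\<close> by auto
    ultimately show "d \<in> {hamming_dist x y | x y. x \<in> ?C \<and> y \<in> ?C \<and> x \<noteq> y}" by blast
  qed
  moreover have "card ?C = 2 ^ m" using card_image[OF inj] by (simp add: card_Pow)
  ultimately show ?thesis using C unfolding block_code_def by blast
qed

theorem corollary3p15:
  fixes k :: real and m :: nat
  assumes "card (UNIV :: 'a::field set) = 4"
    and "2 * k = real m" and "m \<ge> 3"
  shows "\<forall>\<^sub>F d in sequentially. \<forall>n.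
    (\<exists>C :: 'a vec set. block_code n C \<and> additive_code C \<and> real (card C) = 4 powr k \<and> min_dist C = d)
    \<longleftrightarrow> int n \<ge> \<lceil>real_of_int (griesmer_sum m (2 * d)) / 3\<rceil>"
proof -
  have "(4::real) = 2 powr 2" by simp
  then have "4 powr k = (2::real) powr (2 * k)" by (simp only: powr_powr)
  also have "\<dots> = real (2 ^ m)" using assms(2) by (simp add: powr_realpow)
  finally have card_eq: "real (card C) = 4 powr k \<longleftrightarrow> card C = 2 ^ m" for C :: "'a vec set"
    by (metis of_nat_eq_iff)
  have ceil: "int n \<ge> \<lceil>real_of_int g / 3\<rceil> \<longleftrightarrow> g \<le> 3 * int n" for g n
    by linarith
  define j where "j = m - 2"
  define \<Lambda> :: nat where "\<Lambda> = 3 * (2 ^ (j + 2) - 2)"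
  have j: "j \<ge> 1" "m = j + 2" using assms(3) unfolding j_def by auto
  have exists_code: "\<exists>C :: 'a vec set. block_code n C \<and> additive_code C \<and> card C = 2 ^ m \<and> min_dist C = d"
    \<comment> \<open>The added 1 guarantees \<open>d \<ge> 1\<close>.\<close>
    if d: "2 ^ j * (j + \<Lambda> * (2 * (j + \<Lambda>) * 2 ^ j)) + 1 \<le> d"
      and n: "griesmer_sum m (2 * d) \<le> 3 * int n" for d n
  proof -
    obtain xs where xs: "3 * int (length xs) \<le> griesmer_sum m (2 * d) + 2"
      "\<And>u. u \<subseteq> {..<m} \<Longrightarrow> u \<noteq> {} \<Longrightarrow> int d \<le> sum_list (map (pair_weight u) xs)"
      "sum_list (map (pair_weight {1}) xs) = int d"
      using exists_optimal_arrangement[OF j(1) \<Lambda>_def, of d] d unfolding j(2) by auto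
    show ?thesis
    proof (rule exists_additive_code[OF assms(1)])
      \<comment> \<open>The surplus of 2 is lost in integer division by 3.\<close>
      show "length xs \<le> n" using xs(1) n by linarith
    qed (use xs d assms(3) in auto)
  qed
  show ?thesis
    unfolding card_eq ceil eventually_sequentially
  proof (rule exI, intro allI impI iffI)
    fix d n
    assume "\<exists>C :: 'a vec set. block_code n C \<and> additive_code C \<and> card C = 2 ^ m \<and> min_dist C = d"
    then show "griesmer_sum m (2 * d) \<le> 3 * int n"
      using additive_griesmer_bound[OF assms(1), of n _ m] by auto
  qed (rule exists_code)
qed

end
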